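(* Assume ZFC (in particular the axiom of choice). A graph $G$ is isomorphic to a generalized Cayley graph $\mathcal{C}\langle\mathsf{G},\mathsf{H}\rangle$ (for some group $\mathsf{G}$, some non-empty subset $\mathsf{H}\subseteq\mathsf{G}$ and some injective labelling $\langle\ \rangle:\mathsf{H}\to A$) if and only if $G$ is deterministic, co-deterministic, vertex-transitive and simple.
   Context: Fix an arbitrary set $A$ of labels. A graph is a non-empty set $G\subseteq V\times A\times V$ of labelled edges $s\xrightarrow{a}t$; $V_G$ is the set of vertices occurring in edges. Isomorphism: bijection $f:V_G\to V_H$ with $s\xrightarrow{a}_G t\iff f(s)\xrightarrow{a}_H f(t)$; automorphism: isomorphism $G\to G$. $G$ is simple if $s\xrightarrow{a}t,\ s\xrightarrow{b}t\Rightarrow a=b$; deterministic if $r\xrightarrow{a}s,\ r\xrightarrow{a}t\Rightarrow s=t$; co-deterministic if $s\xrightarrow{a}r,\ t\xrightarrow{a}r\Rightarrow s=t$; vertex-transitive if for all $s,t\in V_G$ some automorphism maps $s$ to $t$. For a group $(\mathsf{G},\cdot)$, any non-empty subset $\mathsf{H}\subseteq\mathsf{G}$ and injective $\langle\ \rangle:\mathsf{H}\to A$, the generalized Cayley graph is $\mathcal{C}\langle\mathsf{G},\mathsf{H}\rangle=\{(g,\langle h\rangle,g\cdot h)\mid g\in\mathsf{G},h\in\mathsf{H}\}$. *)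

theory Defs
  imports "HOL-Algebra.Group"
begin

type_synonym ('v, 'a) graph = "('v \<times> 'a \<times> 'v) set"

definition is_graph :: "'a set \<Rightarrow> ('v, 'a) graph \<Rightarrow> bool" where
  "is_graph A G \<longleftrightarrow> G \<noteq> {} \<and> G \<subseteq> UNIV \<times> A \<times> UNIV"

definition vertices :: "('v, 'a) graph \<Rightarrow> 'v set" where
  "vertices G = {v. \<exists>a t. (v, a, t) \<in> G \<or> (t, a, v) \<in> G}"

definition graph_iso :: "('v \<Rightarrow> 'w) \<Rightarrow> ('v, 'a) graph \<Rightarrow> ('w, 'a) graph \<Rightarrow> bool" where
  "graph_iso f G H \<longleftrightarrow> bij_betw f (vertices G) (vertices H) \<and>
     (\<forall>s\<in>vertices G. \<forall>t\<in>vertices G. \<forall>a. (s, a, t) \<in> G \<longleftrightarrow> (f s, a, f t) \<in> H)"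

definition isomorphic :: "('v, 'a) graph \<Rightarrow> ('w, 'a) graph \<Rightarrow> bool" where
  "isomorphic G H \<longleftrightarrow> (\<exists>f. graph_iso f G H)"

abbreviation automorphism :: "('v \<Rightarrow> 'v) \<Rightarrow> ('v, 'a) graph \<Rightarrow> bool" where
  "automorphism f G \<equiv> graph_iso f G G"

definition simple :: "('v, 'a) graph \<Rightarrow> bool" where
  "simple G \<longleftrightarrow> (\<forall>s t a b. (s, a, t) \<in> G \<longrightarrow> (s, b, t) \<in> G \<longrightarrow> a = b)"

definition deterministic :: "('v, 'a) graph \<Rightarrow> bool" where
  "deterministic G \<longleftrightarrow> (\<forall>r a s t. (r, a, s) \<in> G \<longrightarrow> (r, a, t) \<in> G \<longrightarrow> s = t)"

definition co_deterministic :: "('v, 'a) graph \<Rightarrow> bool" where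
  "co_deterministic G \<longleftrightarrow> (\<forall>r a s t. (s, a, r) \<in> G \<longrightarrow> (t, a, r) \<in> G \<longrightarrow> s = t)"

definition vertex_transitive :: "('v, 'a) graph \<Rightarrow> bool" where
  "vertex_transitive G \<longleftrightarrow>
     (\<forall>s\<in>vertices G. \<forall>t\<in>vertices G. \<exists>f. automorphism f G \<and> f s = t)"

definition cayley_graph :: "'g monoid \<Rightarrow> 'g set \<Rightarrow> ('g \<Rightarrow> 'a) \<Rightarrow> ('g, 'a) graph" where
  "cayley_graph K H lab = {(g, lab h, g \<otimes>\<^bsub>K\<^esub> h) | g h. g \<in> carrier K \<and> h \<in> H}"

text \<open>
  HOL cannot quantify existentially over types, so the type in which the group elements live
  is passed as the first argument. Every element of \<open>K\<close> is a vertex of its Cayley graph, so a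
  group over any type whose Cayley graph is isomorphic to \<open>G\<close> can be transported to the set
  \<open>vertices G\<close>; taking \<open>'g\<close> to be the vertex type of \<open>G\<close> loses no generality. The labelling is a total function of which only the
  restriction to \<open>H\<close> matters.
\<close>
definition iso_to_gen_cayley :: "'g itself \<Rightarrow> 'a set \<Rightarrow> ('v, 'a) graph \<Rightarrow> bool" where
  "iso_to_gen_cayley _ A G \<longleftrightarrow>
     (\<exists>(K :: 'g monoid) H (lab :: 'g \<Rightarrow> 'a).
        group K \<and> H \<noteq> {} \<and> H \<subseteq> carrier K \<and> inj_on lab H \<and> lab ` H \<subseteq> A \<and>
        isomorphic G (cayley_graph K H lab))"

end

theory Submission
  imports Defs "HOL-Algebra.Free_Abelian_Groups" "HOL-Algebra.Weak_Morphisms"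
begin

text \<open>
  Translations of a Cayley graph are automorphisms, which gives one direction. Conversely, in a
  deterministic and co-deterministic graph two automorphisms that agree at a vertex agree on its
  whole connected component. Fix a vertex \<open>v0\<close>, automorphisms \<open>\<phi> s\<close> with \<open>\<phi> s v0 = s\<close>, and the
  component \<open>C\<close> of \<open>v0\<close>: then \<open>c \<cdot> d = \<phi> c d\<close> makes \<open>C\<close> a group. Choose one vertex in each
  component, let \<open>R\<close> be the set of these, and put an arbitrary group structure on \<open>R\<close> (this is
  where choice is essential). The map \<open>(c, r) \<mapsto> \<phi> r c\<close> is an isomorphism onto \<open>G\<close> from the
  Cayley graph of \<open>C \<times> R\<close> whose generators are the pairs \<open>(h, \<one>)\<close> with \<open>h\<close> a successor of \<open>v0\<close>.
\<close>

section \<open>Graph isomorphisms\<close>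

lemma edge_vertices: "(s, a, t) \<in> G \<Longrightarrow> s \<in> vertices G \<and> t \<in> vertices G"
  by (auto simp: vertices_def)

lemma graph_iso_vertex: "graph_iso f G H \<Longrightarrow> s \<in> vertices G \<Longrightarrow> f s \<in> vertices H"
  by (auto simp: graph_iso_def bij_betw_def)

lemma graph_iso_inj: "graph_iso f G H \<Longrightarrow> inj_on f (vertices G)"
  by (auto simp: graph_iso_def bij_betw_def)

lemma graph_iso_edge: "graph_iso f G H \<Longrightarrow> (s, a, t) \<in> G \<Longrightarrow> (f s, a, f t) \<in> H"
  using edge_vertices by (fastforce simp: graph_iso_def)

lemma graph_iso_edge_iff:
  "graph_iso f G H \<Longrightarrow> s \<in> vertices G \<Longrightarrow> t \<in> vertices G \<Longrightarrow> (f s, a, f t) \<in> H \<longleftrightarrow> (s, a, t) \<in> G"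
  by (auto simp: graph_iso_def)

lemma graph_iso_id: "graph_iso (\<lambda>x. x) G G"
  by (auto simp: graph_iso_def bij_betw_def)

lemma graph_iso_comp:
  assumes "graph_iso f G H" "graph_iso g H K"
  shows "graph_iso (g \<circ> f) G K"
  unfolding graph_iso_def
proof (intro conjI ballI allI)
  show "bij_betw (g \<circ> f) (vertices G) (vertices K)"
    using assms bij_betw_trans by (auto simp: graph_iso_def)
  fix s t a assume "s \<in> vertices G" "t \<in> vertices G"
  then show "(s, a, t) \<in> G \<longleftrightarrow> ((g \<circ> f) s, a, (g \<circ> f) t) \<in> K"
    using assms by (simp add: graph_iso_edge_iff graph_iso_vertex)
qed

lemma graph_iso_inv:
  assumes "graph_iso f G H"
  shows "graph_iso (inv_into (vertices G) f) H G"
proof -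
  have bij: "bij_betw f (vertices G) (vertices H)"
    using assms by (simp add: graph_iso_def)
  have "(s, a, t) \<in> H \<longleftrightarrow> (inv_into (vertices G) f s, a, inv_into (vertices G) f t) \<in> G"
    if "s \<in> vertices H" "t \<in> vertices H" for s a t
    using graph_iso_edge_iff[OF assms, of "inv_into (vertices G) f s" "inv_into (vertices G) f t" a]
      that bij bij_betw_inv_into_right[OF bij] bij_betwE[OF bij_betw_inv_into[OF bij]] by simp
  then show ?thesis
    using bij_betw_inv_into[OF bij] by (simp add: graph_iso_def)
qed

section \<open>Cayley graphs\<close>

lemma vertices_cayley_graph:
  assumes "group K" "H \<noteq> {}" "H \<subseteq> carrier K"
  shows "vertices (cayley_graph K H lab) = carrier K"
proof -
  interpret group K by fact
  show ?thesis
    using assms(2,3) by (fastforce simp: vertices_def cayley_graph_def)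
qed

text \<open>Left multiplication commutes with right multiplication by a generator, and cancelling
  \<open>k\<close> gives the converse implication for edges.\<close>

lemma cayley_graph_translation:
  assumes "group K" "H \<noteq> {}" "H \<subseteq> carrier K" "k \<in> carrier K"
  shows "automorphism (\<lambda>g. k \<otimes>\<^bsub>K\<^esub> g) (cayley_graph K H lab)"
proof -
  interpret group K by fact
  let ?C = "cayley_graph K H lab"
  have "(s, a, t) \<in> ?C \<longleftrightarrow> (k \<otimes>\<^bsub>K\<^esub> s, a, k \<otimes>\<^bsub>K\<^esub> t) \<in> ?C"
    if "s \<in> carrier K" "t \<in> carrier K" for s a t
  proof -
    have "k \<otimes>\<^bsub>K\<^esub> t = k \<otimes>\<^bsub>K\<^esub> s \<otimes>\<^bsub>K\<^esub> h \<longleftrightarrow> t = s \<otimes>\<^bsub>K\<^esub> h" if "h \<in> H" for h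
      using that assms(3,4) \<open>s \<in> carrier K\<close> \<open>t \<in> carrier K\<close> by (simp add: m_assoc subset_iff)
    then show ?thesis
      using that assms(4) by (auto simp: cayley_graph_def)
  qed
  moreover have "bij_betw (\<lambda>g. k \<otimes>\<^bsub>K\<^esub> g) (carrier K) (carrier K)"
    using inj_on_cmult[OF assms(4)] surj_const_mult[OF assms(4)] by (simp add: bij_betw_def)
  ultimately show ?thesis
    by (simp add: graph_iso_def vertices_cayley_graph[OF assms(1-3)])
qed

lemma vertex_transitive_cayley_graph:
  assumes "group K" "H \<noteq> {}" "H \<subseteq> carrier K"
  shows "vertex_transitive (cayley_graph K H lab)"
proof -
  interpret group K by fact
  have "\<exists>f. automorphism f (cayley_graph K H lab) \<and> f s = t"
    if "s \<in> carrier K" "t \<in> carrier K" for s t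
    using cayley_graph_translation[OF assms, of "t \<otimes>\<^bsub>K\<^esub> inv\<^bsub>K\<^esub> s"] that
    by (intro exI[of _ "\<lambda>g. t \<otimes>\<^bsub>K\<^esub> inv\<^bsub>K\<^esub> s \<otimes>\<^bsub>K\<^esub> g"]) (simp add: m_assoc)
  then show ?thesis
    by (simp add: vertex_transitive_def vertices_cayley_graph[OF assms])
qed

text \<open>Injectivity of \<open>lab\<close> recovers the generator from a label, which gives
  determinism and, with right cancellation, co-determinism. Left cancellation gives
  simplicity.\<close>

lemma cayley_graph_properties:
  assumes "group K" "H \<subseteq> carrier K" "inj_on lab H"
  shows "deterministic (cayley_graph K H lab)" "co_deterministic (cayley_graph K H lab)"
    "simple (cayley_graph K H lab)"
proof -
  interpret group K by fact
  show "deterministic (cayley_graph K H lab)" "co_deterministic (cayley_graph K H lab)"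
    "simple (cayley_graph K H lab)"
    using assms(2,3)
    by (auto simp: deterministic_def co_deterministic_def simple_def cayley_graph_def
        inj_on_eq_iff subset_iff)
qed

section \<open>Invariance of the four properties under isomorphism\<close>

lemma vertex_transitive_iso:
  assumes f: "graph_iso f G H" and H: "vertex_transitive H"
  shows "vertex_transitive G"
  unfolding vertex_transitive_def
proof (intro ballI)
  fix s t assume st: "s \<in> vertices G" "t \<in> vertices G"
  let ?g = "inv_into (vertices G) f"
  obtain h where "automorphism h H" "h (f s) = f t"
    using H st graph_iso_vertex[OF f] unfolding vertex_transitive_def by meson
  \<comment> \<open>Conjugating by \<open>f\<close> turns an automorphism of \<open>H\<close> into
    one of \<open>G\<close>.\<close>
  then have "automorphism (?g \<circ> (h \<circ> f)) G" "(?g \<circ> (h \<circ> f)) s = t"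
    using graph_iso_comp[OF graph_iso_comp[OF f] graph_iso_inv[OF f]] st
      inv_into_f_f[OF graph_iso_inj[OF f]] by simp_all
  then show "\<exists>k. automorphism k G \<and> k s = t" by blast
qed

lemma iso_properties:
  assumes f: "graph_iso f G H"
  shows "deterministic H \<Longrightarrow> deterministic G" "co_deterministic H \<Longrightarrow> co_deterministic G"
    "simple H \<Longrightarrow> simple G"
proof -
  have inj: "f s = f t \<Longrightarrow> s \<in> vertices G \<Longrightarrow> t \<in> vertices G \<Longrightarrow> s = t" for s t
    using graph_iso_inj[OF f] by (simp add: inj_on_eq_iff)
  show "deterministic H \<Longrightarrow> deterministic G"
    unfolding deterministic_def by (meson f graph_iso_edge edge_vertices inj)
  show "co_deterministic H \<Longrightarrow> co_deterministic G"
    unfolding co_deterministic_def by (meson f graph_iso_edge edge_vertices inj)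
  show "simple H \<Longrightarrow> simple G"
    unfolding simple_def by (meson f graph_iso_edge)
qed

lemma iso_to_gen_cayley_imp_properties:
  assumes "iso_to_gen_cayley TYPE('g) A G"
  shows "deterministic G \<and> co_deterministic G \<and> vertex_transitive G \<and> simple G"
proof -
  obtain K :: "'g monoid" and H lab f where
    "group K" "H \<noteq> {}" "H \<subseteq> carrier K" "inj_on lab H" "graph_iso f G (cayley_graph K H lab)"
    using assms unfolding iso_to_gen_cayley_def isomorphic_def by blast
  then show ?thesis
    using iso_properties[of f G "cayley_graph K H lab"]
      vertex_transitive_iso[OF _ vertex_transitive_cayley_graph]
      cayley_graph_properties[of K H lab] by blast
qed

section \<open>Transport of groups\<close>

text \<open>\<open>image_group\<close> renames group elements along \<open>f\<close>. Generators are
  renamed too, and a label is read off after renaming back; \<open>inv_into\<close> is used since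
  \<open>f\<close> is assumed injective only on the carrier.\<close>

lemma graph_iso_image_group:
  assumes "group K" "H \<noteq> {}" "H \<subseteq> carrier K" "inj_on f (carrier K)"
  shows "graph_iso f (cayley_graph K H lab)
           (cayley_graph (image_group f K) (f ` H) (lab \<circ> inv_into (carrier K) f))"
proof -
  interpret group K by fact
  let ?C' = "cayley_graph (image_group f K) (f ` H) (lab \<circ> inv_into (carrier K) f)"
  have inv: "inv_into (carrier K) f (f x) = x" if "x \<in> carrier K" for x
    using assms(4) that by simp
  have C': "(x, a, y) \<in> ?C' \<longleftrightarrow>
      (\<exists>g\<in>carrier K. \<exists>h\<in>H. x = f g \<and> a = lab h \<and> y = f (g \<otimes>\<^bsub>K\<^esub> h))" for x a y
  proof -
    have "(x, a, y) \<in> ?C' \<longleftrightarrow> (\<exists>g\<in>carrier K. \<exists>h\<in>H. x = f g \<and>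
        a = (lab \<circ> inv_into (carrier K) f) (f h) \<and> y = f g \<otimes>\<^bsub>image_group f K\<^esub> f h)"
      unfolding cayley_graph_def image_group_carrier by blast
    moreover have "f g \<otimes>\<^bsub>image_group f K\<^esub> f h = f (g \<otimes>\<^bsub>K\<^esub> h)"
      "(lab \<circ> inv_into (carrier K) f) (f h) = lab h" if "g \<in> carrier K" "h \<in> H" for g h
      using that assms(3) inv by (simp_all add: image_group_def subset_iff)
    ultimately show ?thesis by simp
  qed
  have edge: "(s, a, t) \<in> cayley_graph K H lab \<longleftrightarrow> (f s, a, f t) \<in> ?C'"
    if "s \<in> carrier K" "t \<in> carrier K" for s a t
  proof -
    have "f s = f g \<and> a = lab h \<and> f t = f (g \<otimes>\<^bsub>K\<^esub> h) \<longleftrightarrow> s = g \<and> a = lab h \<and> t = g \<otimes>\<^bsub>K\<^esub> h"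
      if "g \<in> carrier K" "h \<in> H" for g h
      using that \<open>s \<in> carrier K\<close> \<open>t \<in> carrier K\<close> assms(3) inj_on_eq_iff[OF assms(4)]
      by (simp add: subset_iff)
    then show ?thesis
      unfolding C' by (auto simp: cayley_graph_def)
  qed
  have "vertices ?C' = f ` carrier K"
    using vertices_cayley_graph[OF group.inj_imp_image_group_is_group[OF assms(1,4)], of "f ` H"] assms(2,3)
    by (simp add: image_group_carrier image_mono)
  then show ?thesis
    using assms(4) edge
    by (simp add: graph_iso_def vertices_cayley_graph[OF assms(1-3)] bij_betw_def)
qed

text \<open>The carrier of \<open>K\<close> is the whole vertex set of its Cayley graph, so the
  inverse of the isomorphism injects it into the vertex type \<open>'v\<close>. This brings the
  group built below over \<open>'v \<times> 'v\<close> back to \<open>'v\<close>.\<close>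

lemma iso_to_gen_cayley_transport:
  fixes G :: "('v, 'a) graph"
  assumes "iso_to_gen_cayley TYPE('g) A G"
  shows "iso_to_gen_cayley TYPE('v) A G"
proof -
  obtain K :: "'g monoid" and H lab f where K: "group K" "H \<noteq> {}" "H \<subseteq> carrier K"
    and lab: "inj_on lab H" "lab ` H \<subseteq> A" and f: "graph_iso f G (cayley_graph K H lab)"
    using assms unfolding iso_to_gen_cayley_def isomorphic_def by blast
  let ?g = "inv_into (vertices G) f"
  let ?lab = "lab \<circ> inv_into (carrier K) ?g"
  have inj: "inj_on ?g (carrier K)"
    using graph_iso_inj[OF graph_iso_inv[OF f]] unfolding vertices_cayley_graph[OF K] .
  then have inv: "inv_into (carrier K) ?g (?g h) = h" if "h \<in> H" for h
    using inv_into_f_f[OF inj] K(3) that by blast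
  have "inj_on ?lab (?g ` H)" "?lab ` (?g ` H) \<subseteq> A"
    using lab(2) by (auto simp: inv inj_on_eq_iff[OF lab(1)] intro!: inj_onI)
  moreover have "isomorphic G (cayley_graph (image_group ?g K) (?g ` H) ?lab)"
    unfolding isomorphic_def using graph_iso_comp[OF f graph_iso_image_group[OF K inj]] by blast
  moreover have "?g ` H \<subseteq> carrier (image_group ?g K)"
    using K(3) by (simp add: image_group_carrier image_mono)
  ultimately show ?thesis
    unfolding iso_to_gen_cayley_def using group.inj_imp_image_group_is_group[OF K(1) inj] K(2)
    by (intro exI[of _ "image_group ?g K"] exI[of _ "?g ` H"] exI[of _ ?lab] conjI) simp_all
qed

section \<open>Group structures on arbitrary non-empty sets\<close>

lemma group_Fpow_symmetric_difference:
  "group \<lparr>carrier = Fpow A, mult = (\<lambda>X Y. (X - Y) \<union> (Y - X)), one = {}\<rparr>" (is "group ?F")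
proof (rule groupI)
  \<comment> \<open>Under symmetric difference every set is its own inverse.\<close>
  show "\<exists>Y \<in> carrier ?F. Y \<otimes>\<^bsub>?F\<^esub> X = \<one>\<^bsub>?F\<^esub>" if "X \<in> carrier ?F" for X
    using that by (intro bexI[of _ X]) simp_all
qed (auto simp: Fpow_def)

lemma group_structure_bij:
  fixes K :: "('g, 'b) monoid_scheme" and R :: "'v set"
  assumes "group K" "bij_betw f (carrier K) R"
  shows "\<exists>K :: 'v monoid. group K \<and> carrier K = R"
proof -
  have "inj_on f (carrier K)" "carrier (image_group f K) = R"
    using assms(2) by (simp_all add: bij_betw_def image_group_carrier)
  then show ?thesis
    using group.inj_imp_image_group_is_group[OF assms(1)] by blast
qed

text \<open>A finite set copies the cyclic group of its order. An infinite set is equipollent to the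
  set of its finite subsets, which is a group under symmetric difference.\<close>

lemma group_structure_exists:
  fixes R :: "'v set"
  assumes "R \<noteq> {}"
  shows "\<exists>K :: 'v monoid. group K \<and> carrier K = R"
proof (cases "finite R")
  case True
  let ?Z = "integer_mod_group (card R)"
  have "carrier ?Z = {0..<int (card R)}"
    using True assms by (simp add: carrier_integer_mod_group)
  then have "card (carrier ?Z) = card R" "finite (carrier ?Z)" by simp_all
  then obtain f where "bij_betw f (carrier ?Z) R"
    using True finite_same_card_bij by metis
  then show ?thesis
    by (rule group_structure_bij[OF group_integer_mod_group])
next
  case False
  obtain f where "bij_betw f (Fpow R) R"
    using eqpoll_Fpow[OF False] unfolding eqpoll_def by blast
  then show ?thesis
    using group_structure_bij[OF group_Fpow_symmetric_difference, of f R] by simp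
qed

section \<open>Connected components\<close>

definition connected_in :: "('v, 'a) graph \<Rightarrow> 'v \<Rightarrow> 'v \<Rightarrow> bool" where
  "connected_in G = equivclp (\<lambda>s t. \<exists>a. (s, a, t) \<in> G)"

lemma connected_in_refl: "connected_in G s s"
  by (simp add: connected_in_def)

lemma connected_in_sym: "connected_in G s t \<Longrightarrow> connected_in G t s"
  unfolding connected_in_def by (rule equivclp_sym)

lemma connected_in_trans: "connected_in G s t \<Longrightarrow> connected_in G t u \<Longrightarrow> connected_in G s u"
  unfolding connected_in_def by (rule equivclp_trans)

lemma connected_in_edge: "(s, a, t) \<in> G \<Longrightarrow> connected_in G s t"
  unfolding connected_in_def by (rule r_into_equivclp) blast

text \<open>Forward and backward steps are separate cases because determinism handles the former and
  co-determinism the latter in \<open>automorphism_rigid\<close>.\<close>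

lemma connected_in_induct [consumes 1, case_names base edge converse]:
  assumes "connected_in G s t" "P s"
    and "\<And>t u a. P t \<Longrightarrow> (t, a, u) \<in> G \<Longrightarrow> P u"
    and "\<And>t u a. P t \<Longrightarrow> (u, a, t) \<in> G \<Longrightarrow> P u"
  shows "P t"
  using assms(1) unfolding connected_in_def
  by (induction rule: equivclp_induct) (use assms(2-4) in blast)+

lemma connected_in_vertex: "connected_in G s t \<Longrightarrow> s \<in> vertices G \<Longrightarrow> t \<in> vertices G"
  by (induction rule: connected_in_induct) (auto dest: edge_vertices)

lemma connected_in_map:
  assumes f: "automorphism f G" and "connected_in G s t"
  shows "connected_in G (f s) (f t)"
  using assms(2)
proof (induction rule: connected_in_induct)
  case base
  show ?case by (rule connected_in_refl)
next
  case (edge t u a)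
  then show ?case using connected_in_trans connected_in_edge graph_iso_edge[OF f] by metis
next
  case (converse t u a)
  then show ?case
    using connected_in_trans connected_in_sym connected_in_edge graph_iso_edge[OF f] by metis
qed

text \<open>Agreement spreads along a path: at a common image, the label of the next edge determines
  its other end, by determinism for an outgoing edge and by co-determinism for an incoming
  one.\<close>

lemma automorphism_rigid:
  assumes "deterministic G" "co_deterministic G" "automorphism f G" "automorphism g G"
    and "connected_in G s t" "f s = g s"
  shows "f t = g t"
  using assms(5)
proof (induction rule: connected_in_induct)
  case base
  show ?case by fact
next
  case (edge t u a)
  then have "(f t, a, f u) \<in> G" "(f t, a, g u) \<in> G"
    using graph_iso_edge assms(3,4) by metis+
  then show ?case using assms(1) unfolding deterministic_def by blast
next
  case (converse t u a)
  then have "(f u, a, f t) \<in> G" "(g u, a, f t) \<in> G"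
    using graph_iso_edge assms(3,4) by metis+
  then show ?case using assms(2) unfolding co_deterministic_def by blast
qed

section \<open>The group of a vertex-transitive graph\<close>

text \<open>Vertex-transitivity enters through \<open>\<phi>\<close>, an arbitrary choice of one
  automorphism per vertex; no compatibility between the choices is assumed.\<close>

locale transitive_graph =
  fixes G :: "('v, 'a) graph" and v0 :: 'v and \<phi> :: "'v \<Rightarrow> 'v \<Rightarrow> 'v"
  assumes det: "deterministic G" and codet: "co_deterministic G" and simple: "simple G"
    and v0: "v0 \<in> vertices G"
    and aut: "s \<in> vertices G \<Longrightarrow> automorphism (\<phi> s) G"
    and base: "s \<in> vertices G \<Longrightarrow> \<phi> s v0 = s"
begin

abbreviation comp :: "'v set" where
  "comp \<equiv> {c. connected_in G v0 c}"

text \<open>For \<open>c\<close> in \<open>comp\<close>, the restrictions of \<open>\<phi> c\<close>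
  to \<open>comp\<close> form a group acting regularly there; each is identified with its image of
  \<open>v0\<close>. By rigidity the product does not depend on the choice of
  \<open>\<phi>\<close>.\<close>

definition comp_group :: "'v monoid" where
  "comp_group = \<lparr>carrier = comp, mult = \<phi>, one = v0\<rparr>"

text \<open>\<open>SOME\<close> sees only the predicate \<open>connected_in G s\<close>, which is
  the same for all vertices of a component, so one representative serves the whole
  component.\<close>

definition rep :: "'v \<Rightarrow> 'v" where
  "rep s = (SOME t. connected_in G s t)"

abbreviation reps :: "'v set" where
  "reps \<equiv> rep ` vertices G"

lemma comp_vertex: "c \<in> comp \<Longrightarrow> c \<in> vertices G"
  using connected_in_vertex v0 by auto

lemma connected_in_translate:
  "s \<in> vertices G \<Longrightarrow> c \<in> comp \<Longrightarrow> connected_in G s (\<phi> s c)"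
  using connected_in_map[OF aut, of s v0 c] base by simp

text \<open>The inverse of \<open>\<phi> s\<close> sends \<open>s\<close> to \<open>v0\<close>,
  hence the component of \<open>s\<close> into \<open>comp\<close>; the preimage of \<open>t\<close>
  is the required \<open>c\<close>.\<close>

lemma translate_surj:
  assumes "s \<in> vertices G" "connected_in G s t"
  obtains c where "c \<in> comp" "\<phi> s c = t"
proof
  let ?g = "inv_into (vertices G) (\<phi> s)"
  have bij: "bij_betw (\<phi> s) (vertices G) (vertices G)"
    using aut[OF assms(1)] by (simp add: graph_iso_def)
  have "?g s = v0"
    using bij_betw_inv_into_left[OF bij v0] base[OF assms(1)] by simp
  then show "?g t \<in> comp"
    using connected_in_map[OF graph_iso_inv[OF aut[OF assms(1)]] assms(2)] by simp
  show "\<phi> s (?g t) = t"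
    using bij_betw_inv_into_right[OF bij] connected_in_vertex[OF assms(2,1)] by simp
qed

text \<open>This makes up for the arbitrary choice of \<open>\<phi>\<close>: on \<open>comp\<close>,
  any automorphism with the right value at \<open>v0\<close> may replace \<open>\<phi> s\<close>.
  The group laws all rest on it, apart from closure.\<close>

lemma translate_rigid:
  assumes "s \<in> vertices G" "automorphism f G" "f v0 = s" "c \<in> comp"
  shows "\<phi> s c = f c"
  using automorphism_rigid[OF det codet aut[OF assms(1)] assms(2), of v0 c] assms base by simp

lemma translate_edge_iff:
  "s \<in> vertices G \<Longrightarrow> c \<in> vertices G \<Longrightarrow> d \<in> vertices G \<Longrightarrow>
    (\<phi> s c, a, \<phi> s d) \<in> G \<longleftrightarrow> (c, a, d) \<in> G"
  using graph_iso_edge_iff[OF aut] by blast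

lemma group_comp_group: "group comp_group"
proof (rule groupI)
  show "x \<otimes>\<^bsub>comp_group\<^esub> y \<in> carrier comp_group"
    if "x \<in> carrier comp_group" "y \<in> carrier comp_group" for x y
  proof -
    have "x \<in> comp" "y \<in> comp" using that by (simp_all add: comp_group_def)
    then have "connected_in G v0 x" "connected_in G x (\<phi> x y)"
      using connected_in_translate[OF comp_vertex] by simp_all
    then show ?thesis
      using connected_in_trans[of G v0 x "\<phi> x y"] by (simp add: comp_group_def)
  qed
  show "\<one>\<^bsub>comp_group\<^esub> \<in> carrier comp_group"
    by (simp add: comp_group_def connected_in_refl)
  show "x \<otimes>\<^bsub>comp_group\<^esub> y \<otimes>\<^bsub>comp_group\<^esub> z = x \<otimes>\<^bsub>comp_group\<^esub> (y \<otimes>\<^bsub>comp_group\<^esub> z)"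
    if "x \<in> carrier comp_group" "y \<in> carrier comp_group" "z \<in> carrier comp_group" for x y z
  proof -
    have xyz: "x \<in> comp" "y \<in> comp" "z \<in> comp"
      using that by (simp_all add: comp_group_def)
    have xy: "\<phi> x y \<in> vertices G"
      by (rule graph_iso_vertex[OF aut[OF comp_vertex[OF xyz(1)]] comp_vertex[OF xyz(2)]])
    \<comment> \<open>Associativity: both automorphisms send \<open>v0\<close> to
      \<open>\<phi> x y\<close>, so they agree on \<open>comp\<close>.\<close>
    have "\<phi> (\<phi> x y) z = (\<phi> x \<circ> \<phi> y) z"
    proof (rule translate_rigid[OF xy _ _ xyz(3)])
      show "automorphism (\<phi> x \<circ> \<phi> y) G"
        by (rule graph_iso_comp[OF aut[OF comp_vertex[OF xyz(2)]] aut[OF comp_vertex[OF xyz(1)]]])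
      show "(\<phi> x \<circ> \<phi> y) v0 = \<phi> x y"
        using base[OF comp_vertex[OF xyz(2)]] by simp
    qed
    then show ?thesis by (simp add: comp_group_def)
  qed
  \<comment> \<open>\<open>\<phi> v0\<close> need not be the identity map, but it fixes
    \<open>v0\<close> and so agrees with the identity on \<open>comp\<close>.\<close>
  show "\<one>\<^bsub>comp_group\<^esub> \<otimes>\<^bsub>comp_group\<^esub> x = x" if "x \<in> carrier comp_group" for x
    using that translate_rigid[OF v0 graph_iso_id] by (simp add: comp_group_def)
  show "\<exists>y \<in> carrier comp_group. y \<otimes>\<^bsub>comp_group\<^esub> x = \<one>\<^bsub>comp_group\<^esub>"
    if "x \<in> carrier comp_group" for x
  proof -
    have x: "x \<in> comp" "x \<in> vertices G"
      using that comp_vertex unfolding comp_group_def by simp_all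
    let ?g = "inv_into (vertices G) (\<phi> x)"
    have g: "automorphism ?g G" "?g x = v0"
      using graph_iso_inv[OF aut[OF x(2)]] inv_into_f_f[OF graph_iso_inj[OF aut[OF x(2)]] v0]
      unfolding base[OF x(2)] .
    \<comment> \<open>The left inverse of \<open>x\<close> is \<open>?g v0\<close>: translation by
      it agrees with \<open>?g\<close> on \<open>comp\<close>, and \<open>?g\<close> sends
      \<open>x\<close> to \<open>v0\<close>.\<close>
    then have y: "?g v0 \<in> comp"
      using connected_in_map[OF g(1) connected_in_sym, of v0 x] x(1) by simp
    then have "\<phi> (?g v0) x = v0"
      using translate_rigid[OF comp_vertex g(1)] x(1) g(2) by simp
    then show ?thesis
      using y by (intro bexI[of _ "?g v0"]) (simp_all add: comp_group_def)
  qed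
qed

section \<open>Component representatives and coordinates for vertices\<close>

lemma connected_in_rep: "connected_in G s (rep s)"
  unfolding rep_def by (rule someI[where x = s]) (rule connected_in_refl)

lemma rep_eq:
  assumes "connected_in G s t"
  shows "rep s = rep t"
proof -
  have "connected_in G s u \<longleftrightarrow> connected_in G t u" for u
    using connected_in_sym[OF assms] assms connected_in_trans[of G s t u]
      connected_in_trans[of G t s u] by blast
  then show ?thesis by (simp add: rep_def)
qed

lemma reps_vertex: "r \<in> reps \<Longrightarrow> r \<in> vertices G"
  using connected_in_vertex[OF connected_in_rep] by auto

lemma reps_unique:
  assumes "r \<in> reps" "r' \<in> reps" "connected_in G r r'"
  shows "r = r'"
proof -
  have "rep r = r" if "r \<in> reps" for r
    using that rep_eq[OF connected_in_rep] by (metis imageE)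
  then show ?thesis
    using assms(1,2) rep_eq[OF assms(3)] by metis
qed

text \<open>The component of a vertex determines \<open>r\<close>, and then injectivity of
  \<open>\<phi> r\<close> determines \<open>c\<close>. Surjectivity takes \<open>r\<close> to be the
  representative of the given vertex.\<close>

lemma bij_betw_translate: "bij_betw (\<lambda>(c, r). \<phi> r c) (comp \<times> reps) (vertices G)"
  unfolding bij_betw_def
proof
  show "inj_on (\<lambda>(c, r). \<phi> r c) (comp \<times> reps)"
  proof (rule inj_onI, clarify)
    fix c c' s s'
    let ?r = "rep s" and ?r' = "rep s'"
    assume c: "connected_in G v0 c" "connected_in G v0 c'"
      and s: "s \<in> vertices G" "s' \<in> vertices G" and eq: "\<phi> ?r c = \<phi> ?r' c'"
    have "connected_in G ?r (\<phi> ?r c)" "connected_in G ?r' (\<phi> ?r' c')"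
      using c s connected_in_translate reps_vertex by auto
    then have r: "?r = ?r'"
      using reps_unique[of ?r ?r'] s eq connected_in_sym connected_in_trans by (metis imageI)
    then show "c = c' \<and> ?r = ?r'"
      using eq inj_on_eq_iff[OF graph_iso_inj[OF aut[OF reps_vertex]]] c s comp_vertex by auto
  qed
  show "(\<lambda>(c, r). \<phi> r c) ` (comp \<times> reps) = vertices G"
  proof
    show "(\<lambda>(c, r). \<phi> r c) ` (comp \<times> reps) \<subseteq> vertices G"
      using graph_iso_vertex[OF aut[OF reps_vertex]] comp_vertex by auto
    show "vertices G \<subseteq> (\<lambda>(c, r). \<phi> r c) ` (comp \<times> reps)"
    proof
      fix s assume s: "s \<in> vertices G"
      obtain c where "c \<in> comp" "\<phi> (rep s) c = s"
        using translate_surj[of "rep s" s] reps_vertex s connected_in_sym[OF connected_in_rep]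
        by blast
      then show "s \<in> (\<lambda>(c, r). \<phi> r c) ` (comp \<times> reps)"
        using s by (intro image_eqI[of _ _ "(c, rep s)"]) auto
    qed
  qed
qed

section \<open>The isomorphism with a Cayley graph of the product group\<close>

text \<open>Needed for a non-empty generating set. Since \<open>v0\<close> could be only the target
  of the edge at hand, the edge is moved so that its source becomes \<open>v0\<close>.\<close>

lemma successor_exists: "\<exists>a h. (v0, a, h) \<in> G"
proof -
  obtain s a t where edge: "(s, a, t) \<in> G"
    using v0 unfolding vertices_def by blast
  let ?g = "inv_into (vertices G) (\<phi> s)"
  have s: "s \<in> vertices G" using edge edge_vertices by metis
  have "?g s = v0"
    using inv_into_f_f[OF graph_iso_inj[OF aut[OF s]] v0] unfolding base[OF s] .
  then show ?thesis
    using graph_iso_edge[OF graph_iso_inv[OF aut[OF s]] edge] by metis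
qed

lemma iso_to_gen_cayley:
  assumes "is_graph A G"
  shows "iso_to_gen_cayley TYPE('v \<times> 'v) A G"
proof -
  obtain R :: "'v monoid" where R: "group R" "carrier R = reps"
    using group_structure_exists[of reps] v0 by (metis empty_iff image_is_empty)
  interpret R: group R by fact
  let ?K = "comp_group \<times>\<times> R"
  let ?H = "{(h, \<one>\<^bsub>R\<^esub>) | h. \<exists>a. (v0, a, h) \<in> G}"
  \<comment> \<open>The label of the edge from \<open>v0\<close> to the first coordinate. It is
    unique by simplicity when such an edge exists, and unspecified otherwise.\<close>
  define lab where "lab = (\<lambda>p :: 'v \<times> 'v. THE a. (v0, a, fst p) \<in> G)"
  let ?F = "\<lambda>(c, r). \<phi> r c"
  let ?C = "cayley_graph ?K ?H lab"
  have lab: "lab (h, r) = a" if "(v0, a, h) \<in> G" for a h r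
    unfolding lab_def fst_conv
    by (rule the_equality) (use that simple in \<open>unfold simple_def, blast+\<close>)
  have K: "group ?K"
    using group_comp_group R(1) by (rule DirProd_group)
  have carrier: "carrier ?K = comp \<times> reps"
    by (simp add: R(2) comp_group_def)
  have "?H \<noteq> {}"
    using successor_exists by blast
  moreover have "?H \<subseteq> carrier ?K"
    unfolding carrier using R.one_closed R(2) connected_in_edge by fast
  ultimately have H: "?H \<noteq> {}" "?H \<subseteq> carrier ?K" .
  have "inj_on lab ?H"
  proof (rule inj_onI)
    fix p q assume pq: "p \<in> ?H" "q \<in> ?H" "lab p = lab q"
    then obtain h h' a a' where h: "p = (h, \<one>\<^bsub>R\<^esub>)" "q = (h', \<one>\<^bsub>R\<^esub>)"
      and a: "(v0, a, h) \<in> G" "(v0, a', h') \<in> G"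
      by blast
    have "a = a'"
      using pq(3) unfolding h lab[OF a(1)] lab[OF a(2)] .
    \<comment> \<open>Two successors of \<open>v0\<close> reached by the same label coincide by
      determinism.\<close>
    then show "p = q"
      using det a h unfolding deterministic_def by blast
  qed
  moreover have "lab ` ?H \<subseteq> A"
  proof (rule image_subsetI)
    fix p assume "p \<in> ?H"
    then obtain h a where "p = (h, \<one>\<^bsub>R\<^esub>)" "(v0, a, h) \<in> G" by blast
    then show "lab p \<in> A"
      using lab[of a h "\<one>\<^bsub>R\<^esub>"] assms unfolding is_graph_def by auto
  qed
  ultimately have labH: "inj_on lab ?H" "lab ` ?H \<subseteq> A" .
  \<comment> \<open>Generators are trivial in the second coordinate, so each slice with fixed
    \<open>r\<close> is closed under edges and copies one component.\<close>
  have C: "((c, r), a, (c', r')) \<in> ?C \<longleftrightarrow> r' = r \<and> (\<exists>h. (v0, a, h) \<in> G \<and> c' = \<phi> c h)"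
    if "c \<in> comp" "r \<in> reps" for c r a c' r'
  proof -
    have cr: "(c, r) \<in> carrier ?K"
      using that carrier by blast
    have mult: "(c, r) \<otimes>\<^bsub>?K\<^esub> (h, \<one>\<^bsub>R\<^esub>) = (\<phi> c h, r)" for h
      using that(2) R(2) by (simp add: comp_group_def)
    show ?thesis
    proof
      assume "((c, r), a, (c', r')) \<in> ?C"
      then obtain h b where h: "(v0, b, h) \<in> G" "a = lab (h, \<one>\<^bsub>R\<^esub>)"
        and "(c', r') = (c, r) \<otimes>\<^bsub>?K\<^esub> (h, \<one>\<^bsub>R\<^esub>)"
        unfolding cayley_graph_def by blast
      then have "c' = \<phi> c h" "r' = r"
        unfolding mult by blast+
      then show "r' = r \<and> (\<exists>h. (v0, a, h) \<in> G \<and> c' = \<phi> c h)"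
        using h(1) unfolding h(2) lab[OF h(1)] by blast
    next
      assume "r' = r \<and> (\<exists>h. (v0, a, h) \<in> G \<and> c' = \<phi> c h)"
      then obtain h where h: "(v0, a, h) \<in> G" "(c', r') = (c, r) \<otimes>\<^bsub>?K\<^esub> (h, \<one>\<^bsub>R\<^esub>)"
        unfolding mult by blast
      have "((c, r), lab (h, \<one>\<^bsub>R\<^esub>), (c, r) \<otimes>\<^bsub>?K\<^esub> (h, \<one>\<^bsub>R\<^esub>)) \<in> ?C"
        unfolding cayley_graph_def using cr h(1) by blast
      then show "((c, r), a, (c', r')) \<in> ?C"
        unfolding lab[OF h(1)] h(2) .
    qed
  qed
  have edge: "((c, r), a, (c', r')) \<in> ?C \<longleftrightarrow> (\<phi> r c, a, \<phi> r' c') \<in> G"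
    if cr: "c \<in> comp" "r \<in> reps" "c' \<in> comp" "r' \<in> reps" for c r a c' r'
  proof -
    note vs = comp_vertex[OF cr(1)] comp_vertex[OF cr(3)] reps_vertex[OF cr(2)]
    show ?thesis
    proof
      assume "((c, r), a, (c', r')) \<in> ?C"
      then obtain h where h: "r' = r" "(v0, a, h) \<in> G" "c' = \<phi> c h"
        using C[OF cr(1,2)] by blast
      have "(\<phi> c v0, a, \<phi> c h) \<in> G"
        by (rule graph_iso_edge[OF aut[OF vs(1)] h(2)])
      then have "(c, a, c') \<in> G"
        unfolding base[OF vs(1)] h(3) .
      then show "(\<phi> r c, a, \<phi> r' c') \<in> G"
        unfolding h(1) by (rule graph_iso_edge[OF aut[OF vs(3)]])
    next
      assume e: "(\<phi> r c, a, \<phi> r' c') \<in> G"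
      \<comment> \<open>The edge puts \<open>r\<close> and \<open>r'\<close> in one component, which
        forces them to be equal.\<close>
      have "connected_in G r (\<phi> r c)" "connected_in G (\<phi> r' c') r'"
        using connected_in_translate[OF vs(3) cr(1)]
          connected_in_sym[OF connected_in_translate[OF reps_vertex cr(3)]] cr(4) by blast+
      then have "connected_in G r r'"
        using connected_in_edge[OF e] by (blast intro: connected_in_trans)
      then have rr': "r = r'"
        by (rule reps_unique[OF cr(2,4)])
      have cc': "(c, a, c') \<in> G"
        using e translate_edge_iff[OF vs(3,1,2)] unfolding rr' by blast
      \<comment> \<open>The generator \<open>h\<close> is the quotient of \<open>c'\<close> by
        \<open>c\<close> on the left; undoing \<open>\<phi> c\<close> moves the edge back to
        \<open>v0\<close>.\<close>
      obtain h where h: "h \<in> comp" "\<phi> c h = c'"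
        using translate_surj[OF vs(1) connected_in_edge[OF cc']] by blast
      have "(\<phi> c v0, a, \<phi> c h) \<in> G"
        unfolding base[OF vs(1)] h(2) by (rule cc')
      then have "(v0, a, h) \<in> G"
        using translate_edge_iff[OF vs(1) v0 comp_vertex[OF h(1)]] by blast
      then show "((c, r), a, (c', r')) \<in> ?C"
        using C[OF cr(1,2)] rr' h(2) by blast
    qed
  qed
  have "graph_iso ?F ?C G"
    unfolding graph_iso_def vertices_cayley_graph[OF K H] carrier
  proof (intro conjI ballI allI bij_betw_translate)
    fix p q a assume "p \<in> comp \<times> reps" "q \<in> comp \<times> reps"
    then obtain c r c' r' where pq: "p = (c, r)" "q = (c', r')"
      and cr: "c \<in> comp" "r \<in> reps" "c' \<in> comp" "r' \<in> reps"
      by blast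
    show "(p, a, q) \<in> ?C \<longleftrightarrow> (?F p, a, ?F q) \<in> G"
      unfolding pq prod.case by (rule edge[OF cr])
  qed
  then have "isomorphic G ?C"
    unfolding isomorphic_def by (intro exI) (rule graph_iso_inv)
  then show ?thesis
    unfolding iso_to_gen_cayley_def using K H labH
    by (intro exI[of _ ?K] exI[of _ ?H] exI[of _ lab] conjI)
qed

end

text \<open>The equivalence uses groups over the vertex type, which transport makes sufficient. The
  second conjunct extends the necessity of the four properties to groups over an arbitrary type
  \<open>'g\<close>.\<close>

theorem theorem4p16:
  fixes A :: "'a set" and G :: "('v, 'a) graph"
  assumes "is_graph A G"
  shows "(iso_to_gen_cayley TYPE('v) A G \<longleftrightarrow>
            deterministic G \<and> co_deterministic G \<and> vertex_transitive G \<and> simple G) \<and>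
         (iso_to_gen_cayley TYPE('g) A G \<longrightarrow>
            deterministic G \<and> co_deterministic G \<and> vertex_transitive G \<and> simple G)"
proof -
  have "iso_to_gen_cayley TYPE('v) A G"
    if G: "deterministic G" "co_deterministic G" "vertex_transitive G" "simple G"
  proof -
    obtain v0 where v0: "v0 \<in> vertices G"
      using assms edge_vertices unfolding is_graph_def by fastforce
    have "\<forall>s\<in>vertices G. \<exists>f. automorphism f G \<and> f v0 = s"
      using G(3) v0 by (simp add: vertex_transitive_def)
    \<comment> \<open>The choice of one automorphism for each vertex.\<close>
    then obtain \<phi> where "\<forall>s\<in>vertices G. automorphism (\<phi> s) G \<and> \<phi> s v0 = s"
      by metis
    then interpret transitive_graph G v0 \<phi>
      using G v0 by unfold_locales auto
    show ?thesis
      using iso_to_gen_cayley[OF assms] by (rule iso_to_gen_cayley_transport)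
  qed
  then show ?thesis
    using iso_to_gen_cayley_imp_properties[where A = A and G = G and 'g = 'v]
      iso_to_gen_cayley_imp_properties[where A = A and G = G and 'g = 'g] by blast
qed

end
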